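(* Let $\mathbb{V}$ be a real vector space of dimension $d$ with $3\le d<6$, equipped with an inner product $\langle -,-\rangle$ of euclidean or lorentzian signature, and let $F\in\Lambda^3\mathbb{V}^*$. Then $[\iota_X F, F]=0$ for all $X\in\mathbb{V}$ if and only if $F$ is simple.
   Context: An inner product is a nondegenerate symmetric bilinear form; euclidean means positive-definite, and lorentzian means of signature $(1,\dim\mathbb{V}-1)$ (one timelike direction). $\iota_X F$ is the $2$-form $F(X,-,-)$. A $2$-form $\omega\in\Lambda^2\mathbb{V}^*\cong\mathfrak{so}(\mathbb{V})$ acts on forms $\Omega\in\Lambda\mathbb{V}^*$ by $[\omega,\Omega]$, defined for $\omega=\alpha\wedge\beta$ with $\alpha,\beta\in\mathbb{V}^*$ by $$[\alpha\wedge\beta,\Omega]=\alpha\wedge\iota_{\beta^\sharp}\Omega-\beta\wedge\iota_{\alpha^\sharp}\Omega$$ and extended linearly in $\omega$, where $\alpha^\sharp\in\mathbb{V}$ is the vector dual to $\alpha$ under the inner product. A $p$-form is simple if it can be written as a wedge product of $p$ one-forms (in particular the zero form is simple). *)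

theory Defs
  imports "HOL-Analysis.Analysis"
begin

section \<open>Inner products\<close>

definition inner_product :: "('a::real_vector \<Rightarrow> 'a \<Rightarrow> real) \<Rightarrow> bool" where
  "inner_product g \<longleftrightarrow>
     bilinear g \<and> (\<forall>x y. g x y = g y x) \<and> (\<forall>x. (\<forall>y. g x y = 0) \<longrightarrow> x = 0)"

text \<open>Signature \<open>(t, s)\<close> counts timelike (negative) directions first.\<close>

definition has_signature :: "('a::real_vector \<Rightarrow> 'a \<Rightarrow> real) \<Rightarrow> nat \<Rightarrow> nat \<Rightarrow> bool" where
  "has_signature g t s \<longleftrightarrow>
     (\<exists>T S. finite T \<and> finite S \<and> T \<inter> S = {} \<and> card T = t \<and> card S = s \<and>
        independent (T \<union> S) \<and> span (T \<union> S) = UNIV \<and>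
        (\<forall>x\<in>T \<union> S. \<forall>y\<in>T \<union> S. x \<noteq> y \<longrightarrow> g x y = 0) \<and>
        (\<forall>x\<in>T. g x x < 0) \<and> (\<forall>x\<in>S. g x x > 0))"

definition euclidean_product :: "('a::real_vector \<Rightarrow> 'a \<Rightarrow> real) \<Rightarrow> bool" where
  "euclidean_product g \<longleftrightarrow> inner_product g \<and> (\<forall>x. x \<noteq> 0 \<longrightarrow> g x x > 0)"

definition lorentzian_product :: "('a::real_vector \<Rightarrow> 'a \<Rightarrow> real) \<Rightarrow> bool" where
  "lorentzian_product g \<longleftrightarrow> inner_product g \<and> has_signature g 1 (dim (UNIV :: 'a set) - 1)"


section \<open>Exterior forms\<close>

text \<open>An element of the exterior algebra of the dual space is a function on argument lists:
  its component of degree \<open>p\<close> is its restriction to lists of length \<open>p\<close>.  In particular a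
  one-form \<open>\<alpha>\<close> is evaluated on a vector \<open>v\<close> as \<open>\<alpha> [v]\<close>.\<close>

type_synonym 'a form = "'a list \<Rightarrow> real"

definition forms :: "nat \<Rightarrow> ('a::real_vector) form set" where
  "forms p = {\<Omega>.
     (\<forall>xs. length xs \<noteq> p \<longrightarrow> \<Omega> xs = 0) \<and>
     (\<forall>as bs. linear (\<lambda>v. \<Omega> (as @ v # bs))) \<and>
     (\<forall>xs. \<not> distinct xs \<longrightarrow> \<Omega> xs = 0)}"

text \<open>The wedge product as a sum over shuffles: the positions in \<open>I\<close> are fed to the first factor,
  and the sign is that of the shuffle. Hence
  \<open>(\<alpha> \<and> \<beta>)(v, w) = \<alpha> v * \<beta> w - \<alpha> w * \<beta> v\<close> for one-forms.\<close>

definition wedge :: "'a form \<Rightarrow> 'a form \<Rightarrow> 'a form" where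
  "wedge \<Phi> \<Psi> = (\<lambda>xs. \<Sum>I\<in>Pow {..<length xs}.
     (-1) ^ card {(i, j). i \<in> I \<and> j \<notin> I \<and> j < i} * \<Phi> (nths xs I) * \<Psi> (nths xs (- I)))"

definition unit_form :: "'a form" where
  "unit_form = (\<lambda>xs. if xs = [] then 1 else 0)"

definition simple_form :: "nat \<Rightarrow> ('a::real_vector) form \<Rightarrow> bool" where
  "simple_form p \<Omega> \<longleftrightarrow>
     (\<exists>\<alpha>s. length \<alpha>s = p \<and> set \<alpha>s \<subseteq> forms 1 \<and> \<Omega> = foldr wedge \<alpha>s unit_form)"

definition interior_product :: "'a \<Rightarrow> 'a form \<Rightarrow> 'a form" where
  "interior_product X \<Omega> = (\<lambda>xs. \<Omega> (X # xs))"

definition sharp :: "('a \<Rightarrow> 'a \<Rightarrow> real) \<Rightarrow> 'a form \<Rightarrow> 'a" where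
  "sharp g \<alpha> = (THE v. \<forall>w. g v w = \<alpha> [w])"


section \<open>The action of two-forms on forms\<close>

text \<open>\<open>L\<close> is linear on two-forms and has the prescribed values on wedge products of one-forms.\<close>

definition is_so_action :: "('a::real_vector \<Rightarrow> 'a \<Rightarrow> real) \<Rightarrow> 'a form \<Rightarrow> ('a form \<Rightarrow> 'a form) \<Rightarrow> bool"
  where
  "is_so_action g \<Omega> L \<longleftrightarrow>
     (\<forall>\<omega>\<in>forms 2. \<forall>\<eta>\<in>forms 2. \<forall>a b.
        L (\<lambda>xs. a * \<omega> xs + b * \<eta> xs) = (\<lambda>xs. a * L \<omega> xs + b * L \<eta> xs)) \<and>
     (\<forall>\<alpha>\<in>forms 1. \<forall>\<beta>\<in>forms 1.
        L (wedge \<alpha> \<beta>) = (\<lambda>xs. wedge \<alpha> (interior_product (sharp g \<beta>) \<Omega>) xs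
                              - wedge \<beta> (interior_product (sharp g \<alpha>) \<Omega>) xs))"

definition so_action :: "('a::real_vector \<Rightarrow> 'a \<Rightarrow> real) \<Rightarrow> 'a form \<Rightarrow> 'a form \<Rightarrow> 'a form" where
  "so_action g \<omega> \<Omega> = (THE \<Theta>. \<exists>L. is_so_action g \<Omega> L \<and> \<Theta> = L \<omega>)"


subsection \<open>Well-definedness\<close>

lemma formsD_length: "\<Omega> \<in> forms p \<Longrightarrow> length xs \<noteq> p \<Longrightarrow> \<Omega> xs = 0"
  and formsD_linear: "\<Omega> \<in> forms p \<Longrightarrow> linear (\<lambda>v. \<Omega> (as @ v # bs))"
  and formsD_distinct: "\<Omega> \<in> forms p \<Longrightarrow> \<not> distinct xs \<Longrightarrow> \<Omega> xs = 0"
  by (auto simp: forms_def)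

lemma forms_swap:
  assumes "\<Omega> \<in> forms p"
  shows "\<Omega> (as @ a # b # bs) = - \<Omega> (as @ b # a # bs)"
proof -
  have add1: "\<Omega> (as @ (x + y) # c # bs) = \<Omega> (as @ x # c # bs) + \<Omega> (as @ y # c # bs)" for x y c
    using linear_add[OF formsD_linear[OF assms, of as "c # bs"]] by simp
  have add2: "\<Omega> (as @ c # (x + y) # bs) = \<Omega> (as @ c # x # bs) + \<Omega> (as @ c # y # bs)" for x y c
    using linear_add[OF formsD_linear[OF assms, of "as @ [c]" bs]] by simp
  have z: "\<Omega> (as @ c # c # bs) = 0" for c
    by (rule formsD_distinct[OF assms]) simp
  have "\<Omega> (as @ (a + b) # (a + b) # bs) = \<Omega> (as @ a # b # bs) + \<Omega> (as @ b # a # bs)"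
    unfolding add1 add2 by (simp add: z)
  moreover have "\<Omega> (as @ (a + b) # (a + b) # bs) = 0" by (rule z)
  ultimately show ?thesis by linarith
qed

lemma forms_move:
  assumes "\<Omega> \<in> forms p"
  shows "\<Omega> (cs @ u # as @ bs) = (-1) ^ length as * \<Omega> (cs @ as @ u # bs)"
proof (induction as arbitrary: cs)
  case (Cons a as)
  have "\<Omega> (cs @ u # (a # as) @ bs) = - \<Omega> ((cs @ [a]) @ u # as @ bs)"
    using forms_swap[OF assms, of cs u a "as @ bs"] by simp
  also have "\<dots> = - ((-1) ^ length as * \<Omega> ((cs @ [a]) @ as @ u # bs))"
    by (simp only: Cons.IH)
  finally show ?case by simp
qed simp

lemma nths_singleton_set: "i < length xs \<Longrightarrow> nths xs {i} = [xs ! i]"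
proof (induction xs arbitrary: i)
  case (Cons x xs)
  show ?case
  proof (cases i)
    case 0
    then show ?thesis by (simp add: nths_Cons)
  next
    case (Suc k)
    have "{j. Suc j = Suc k} = {k}" by auto
    with Suc Cons show ?thesis by (simp add: nths_Cons)
  qed
qed simp

lemma nths_Compl_singleton:
  "i < length xs \<Longrightarrow> nths xs (- {i}) = take i xs @ drop (Suc i) xs"
proof (induction xs arbitrary: i)
  case (Cons x xs)
  show ?case
  proof (cases i)
    case 0
    then show ?thesis by (simp add: nths_Cons nths_all)
  next
    case (Suc k)
    have "{j. Suc j \<noteq> Suc k} = - {k}" by auto
    with Suc Cons show ?thesis by (simp add: nths_Cons)
  qed
qed simp

lemma wedge_one_form:
  assumes "\<alpha> \<in> forms 1"
  shows "wedge \<alpha> \<Psi> xs =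
    (\<Sum>i<length xs. (-1) ^ i * \<alpha> [xs ! i] * \<Psi> (take i xs @ drop (Suc i) xs))"
proof -
  let ?f = "\<lambda>I. (-1) ^ card {(i, j). i \<in> I \<and> j \<notin> I \<and> j < i} * \<alpha> (nths xs I) * \<Psi> (nths xs (- I))"
  let ?S = "(\<lambda>i. {i}) ` {..<length xs}"
  have "sum ?f (Pow {..<length xs}) = sum ?f ?S"
  proof (rule sum.mono_neutral_right)
    show "\<forall>I\<in>Pow {..<length xs} - ?S. ?f I = 0"
    proof
      fix I assume I: "I \<in> Pow {..<length xs} - ?S"
      have "{i. i < length xs \<and> i \<in> I} = I" using I by auto
      moreover have "card I \<noteq> 1"
        using I by (auto simp: card_1_singleton_iff)
      ultimately have "length (nths xs I) \<noteq> 1" by (simp add: length_nths)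
      then show "?f I = 0" using formsD_length[OF assms] by simp
    qed
  qed auto
  also have "\<dots> = (\<Sum>i<length xs. ?f {i})"
    by (subst sum.reindex) (auto simp: inj_on_def)
  also have "\<dots> = (\<Sum>i<length xs. (-1) ^ i * \<alpha> [xs ! i] * \<Psi> (take i xs @ drop (Suc i) xs))"
  proof (rule sum.cong[OF refl])
    fix i assume "i \<in> {..<length xs}"
    moreover have "{(k, j). k \<in> {i} \<and> j \<notin> {i} \<and> j < k} = {i} \<times> {..<i}" by auto
    then have "card {(k, j). k \<in> {i} \<and> j \<notin> {i} \<and> j < k} = i" by (simp add: card_cartesian_product)
    ultimately show "?f {i} = (-1) ^ i * \<alpha> [xs ! i] * \<Psi> (take i xs @ drop (Suc i) xs)"
      by (simp add: nths_singleton_set nths_Compl_singleton)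
  qed
  finally show ?thesis by (simp add: wedge_def)
qed

lemma wedge_one_one:
  assumes "\<alpha> \<in> forms 1" "\<beta> \<in> forms 1"
  shows "wedge \<alpha> \<beta> [v, w] = \<alpha> [v] * \<beta> [w] - \<alpha> [w] * \<beta> [v]"
  using assms by (simp add: wedge_one_form)

lemma wedge_one_one_outside:
  assumes "\<alpha> \<in> forms 1" "\<beta> \<in> forms 1" "length xs \<noteq> 2"
  shows "wedge \<alpha> \<beta> xs = 0"
  unfolding wedge_one_form[OF assms(1)]
  by (rule sum.neutral) (use assms formsD_length[OF assms(2)] in auto)

lemma interior_product_forms:
  assumes "\<Omega> \<in> forms (Suc p)"
  shows "interior_product X \<Omega> \<in> forms p"
  unfolding forms_def interior_product_def
  using formsD_length[OF assms] formsD_distinct[OF assms] formsD_linear[OF assms, of "X # as" for as]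
  by auto

lemma sharp_eqI:
  fixes g :: "'a::real_vector \<Rightarrow> 'a \<Rightarrow> real"
  assumes g: "inner_product g" and eq: "\<And>w. g v w = \<alpha> [w]"
  shows "sharp g \<alpha> = v"
  unfolding sharp_def
proof (rule the_equality)
  fix u assume u: "\<forall>w. g u w = \<alpha> [w]"
  have l1: "linear (\<lambda>x. g x y)" for y using g by (auto simp: inner_product_def bilinear_def)
  have "g (u - v) w = 0" for w using u eq by (simp add: linear_diff[OF l1])
  then have "u - v = 0" using g unfolding inner_product_def by blast
  then show "u = v" by simp
qed (use eq in auto)

lemma sharp_works:
  fixes g :: "'a::real_vector \<Rightarrow> 'a \<Rightarrow> real"
  assumes g: "inner_product g" and d: "dim (UNIV :: 'a set) > 0" and \<alpha>: "\<alpha> \<in> forms 1"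
  shows "g (sharp g \<alpha>) w = \<alpha> [w]"
proof -
  obtain B :: "'a set" where B: "independent B" "span B = UNIV" "card B = dim (UNIV :: 'a set)"
    by (rule real_vector.basis_exists[of UNIV]) (auto simp: top_unique)
  then have fin: "finite B" using d by (metis card_gt_0_iff)
  have l1: "linear (\<lambda>x. g x y)" and l2: "linear (g x)" for x y
    using g by (auto simp: inner_product_def bilinear_def)
  have la: "linear (\<lambda>v. \<alpha> [v])" using formsD_linear[OF \<alpha>, of "[]" "[]"] by simp
  define \<phi> where "\<phi> v = (\<Sum>b\<in>B. g v b *\<^sub>R b)" for v
  have "linear \<phi>"
    unfolding \<phi>_def by (rule linearI)
      (simp_all add: linear_add[OF l1] linear_scale[OF l1] scaleR_add_left sum.distrib scaleR_sum_right)
  moreover have inj: "inj \<phi>"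
  proof (subst linear_injective_0[OF \<open>linear \<phi>\<close>], intro allI impI)
    fix v assume "\<phi> v = 0"
    then have "\<forall>b\<in>B. g v b = 0"
      unfolding \<phi>_def using real_vector.independentD[OF B(1) fin subset_refl, of "g v"] by auto
    then have "g v w = 0" for w
      using linear_eq_0_on_span[OF l2, of B v w] B(2) by auto
    then show "v = 0" using g by (auto simp: inner_product_def)
  qed
  ultimately have ind: "independent (\<phi> ` B)"
    using B by (intro linear_independent_injective_image) (auto intro: inj_on_subset)
  have card: "card (\<phi> ` B) = card B"
    by (rule card_image[OF inj_on_subset[OF inj subset_UNIV]])
  have "UNIV \<subseteq> span (\<phi> ` B)"
  proof
    fix x
    show "x \<in> span (\<phi> ` B)"
    proof (rule ccontr)
      assume x: "x \<notin> span (\<phi> ` B)"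
      then have "independent (insert x (\<phi> ` B))"
        using ind by (rule real_vector.independent_insertI)
      from real_vector.independent_span_bound[OF fin this]
      have "card (insert x (\<phi> ` B)) \<le> card B"
        unfolding B(2) by blast
      moreover have "x \<notin> \<phi> ` B"
        using x real_vector.span_base[of x "\<phi> ` B"] by blast
      then have "card (insert x (\<phi> ` B)) = Suc (card B)"
        using card_insert_disjoint[of "\<phi> ` B" x] fin card by simp
      ultimately show False by linarith
    qed
  qed
  then have "surj \<phi>"
    using linear_span_image[OF \<open>linear \<phi>\<close>, of B] by auto
  then obtain v where v: "\<phi> v = (\<Sum>b\<in>B. \<alpha> [b] *\<^sub>R b)" by (metis surj_def)
  then have "(\<Sum>b\<in>B. (g v b - \<alpha> [b]) *\<^sub>R b) = 0"
    by (simp add: \<phi>_def scaleR_diff_left sum_subtractf)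
  then have "\<forall>b\<in>B. g v b = \<alpha> [b]"
    using real_vector.independentD[OF B(1) fin subset_refl, of "\<lambda>b. g v b - \<alpha> [b]"] by auto
  then have ex: "\<forall>w. g v w = \<alpha> [w]"
    using linear_eq_on_span[OF l2 la, of B v] B(2) by auto
  then have "sharp g \<alpha> = v"
    by (intro sharp_eqI[OF g]) simp
  then show ?thesis using ex by simp
qed

lemma sharp_lincomb:
  fixes g :: "'a::real_vector \<Rightarrow> 'a \<Rightarrow> real"
  assumes g: "inner_product g" and d: "dim (UNIV :: 'a set) > 0"
    and \<alpha>: "\<alpha> \<in> forms 1" and \<beta>: "\<beta> \<in> forms 1" and \<gamma>: "\<And>w. \<gamma> [w] = a * \<alpha> [w] + b * \<beta> [w]"
  shows "sharp g \<gamma> = a *\<^sub>R sharp g \<alpha> + b *\<^sub>R sharp g \<beta>"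
proof (rule sharp_eqI[OF g])
  fix w
  have l1: "linear (\<lambda>x. g x y)" for y using g by (auto simp: inner_product_def bilinear_def)
  show "g (a *\<^sub>R sharp g \<alpha> + b *\<^sub>R sharp g \<beta>) w = \<gamma> [w]"
    by (simp add: linear_add[OF l1] linear_scale[OF l1] sharp_works[OF g d \<alpha>] sharp_works[OF g d \<beta>] \<gamma>)
qed

lemma forms_lincomb:
  assumes "\<omega> \<in> forms p" "\<eta> \<in> forms p"
  shows "(\<lambda>xs. a * \<omega> xs + b * \<eta> xs) \<in> forms p"
proof -
  have "linear (\<lambda>v. a * \<omega> (as @ v # bs) + b * \<eta> (as @ v # bs))" for as bs
    using linear_compose_add[OF linear_compose_scale_right[OF formsD_linear[OF assms(1), of as bs], of a]
        linear_compose_scale_right[OF formsD_linear[OF assms(2), of as bs], of b]] by simp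
  then show ?thesis
    using assms by (auto simp: forms_def)
qed

lemma wedge_one_one_forms:
  assumes \<alpha>: "\<alpha> \<in> forms 1" and \<beta>: "\<beta> \<in> forms 1"
  shows "wedge \<alpha> \<beta> \<in> forms 2"
proof -
  have la: "linear (\<lambda>v. \<alpha> [v])" "linear (\<lambda>v. \<beta> [v])"
    using formsD_linear[OF \<alpha>, of "[]" "[]"] formsD_linear[OF \<beta>, of "[]" "[]"] by auto
  have z: "wedge \<alpha> \<beta> xs = 0" if "\<not> distinct xs" for xs
  proof (cases "length xs = 2")
    case True
    then obtain v w where "xs = [v, w]" by (auto simp: numeral_2_eq_2 length_Suc_conv)
    with that show ?thesis by (auto simp: wedge_one_one[OF \<alpha> \<beta>])
  qed (rule wedge_one_one_outside[OF \<alpha> \<beta>])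
  have "linear (\<lambda>v. wedge \<alpha> \<beta> (as @ v # bs))" for as bs
  proof (cases "length as + length bs = 1")
    case True
    then consider c where "as = [c]" "bs = []" | c where "as = []" "bs = [c]"
      by (auto simp: length_Suc_conv add_is_1)
    then show ?thesis
    proof cases
      case 1
      show ?thesis unfolding 1
        by (rule linearI)
          (simp_all add: wedge_one_one[OF \<alpha> \<beta>] linear_add[OF la(1)] linear_add[OF la(2)]
            linear_scale[OF la(1)] linear_scale[OF la(2)] algebra_simps)
    next
      case 2
      show ?thesis unfolding 2
        by (rule linearI)
          (simp_all add: wedge_one_one[OF \<alpha> \<beta>] linear_add[OF la(1)] linear_add[OF la(2)]
            linear_scale[OF la(1)] linear_scale[OF la(2)] algebra_simps)
    qed
  next
    case False
    then have "wedge \<alpha> \<beta> (as @ v # bs) = 0" for v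
      by (intro wedge_one_one_outside[OF \<alpha> \<beta>]) auto
    then show ?thesis by (simp add: linear_zero)
  qed
  with z show ?thesis
    unfolding forms_def using wedge_one_one_outside[OF \<alpha> \<beta>] by auto
qed

text \<open>An explicit formula for the action: a two-form acts on each argument in turn as an
  endomorphism, via the identification of two-forms with skew endomorphisms.\<close>

definition insert_action :: "('a::real_vector \<Rightarrow> 'a \<Rightarrow> real) \<Rightarrow> 'a form \<Rightarrow> 'a form \<Rightarrow> 'a form" where
  "insert_action g \<omega> \<Omega> = (\<lambda>xs. \<Sum>i<length xs.
     \<Omega> (take i xs @ sharp g (interior_product (xs ! i) \<omega>) # drop (Suc i) xs))"

lemma wedge_one_interior:
  assumes \<alpha>: "\<alpha> \<in> forms 1" and \<Omega>: "\<Omega> \<in> forms p"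
  shows "wedge \<alpha> (interior_product v \<Omega>) xs =
    (\<Sum>i<length xs. \<alpha> [xs ! i] * \<Omega> (take i xs @ v # drop (Suc i) xs))"
  unfolding wedge_one_form[OF \<alpha>]
proof (rule sum.cong[OF refl])
  fix i assume "i \<in> {..<length xs}"
  then have ip: "interior_product v \<Omega> (take i xs @ drop (Suc i) xs)
      = (-1) ^ i * \<Omega> (take i xs @ v # drop (Suc i) xs)"
    using forms_move[OF \<Omega>, of "[]" v "take i xs" "drop (Suc i) xs"]
    by (simp add: interior_product_def)
  have "(-1) ^ i * a * ((-1) ^ i * b) = a * b" for a b :: real
    by (cases "even i") auto
  then show "(-1) ^ i * \<alpha> [xs ! i] * interior_product v \<Omega> (take i xs @ drop (Suc i) xs)
      = \<alpha> [xs ! i] * \<Omega> (take i xs @ v # drop (Suc i) xs)"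
    by (simp only: ip)
qed

lemma is_so_action_insert_action:
  fixes g :: "'a::real_vector \<Rightarrow> 'a \<Rightarrow> real"
  assumes g: "inner_product g" and d: "dim (UNIV :: 'a set) > 0" and \<Omega>: "\<Omega> \<in> forms p"
  shows "is_so_action g \<Omega> (\<lambda>\<omega>. insert_action g \<omega> \<Omega>)"
proof -
  have lc: "\<Omega> (as @ (a *\<^sub>R u + b *\<^sub>R v) # bs) = a * \<Omega> (as @ u # bs) + b * \<Omega> (as @ v # bs)"
    for as bs a b u v
    by (simp add: linear_add[OF formsD_linear[OF \<Omega>]] linear_scale[OF formsD_linear[OF \<Omega>]])
  have A: "insert_action g (\<lambda>xs. a * \<omega> xs + b * \<eta> xs) \<Omega> xs
      = a * insert_action g \<omega> \<Omega> xs + b * insert_action g \<eta> \<Omega> xs"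
    if \<omega>: "\<omega> \<in> forms 2" and \<eta>: "\<eta> \<in> forms 2" for \<omega> \<eta> a b xs
  proof -
    have "interior_product x \<omega> \<in> forms 1" "interior_product x \<eta> \<in> forms 1" for x
      using \<omega> \<eta> by (auto intro!: interior_product_forms simp: numeral_2_eq_2)
    then have "sharp g (interior_product x (\<lambda>xs. a * \<omega> xs + b * \<eta> xs))
        = a *\<^sub>R sharp g (interior_product x \<omega>) + b *\<^sub>R sharp g (interior_product x \<eta>)" for x
      by (intro sharp_lincomb[OF g d]) (auto simp: interior_product_def)
    then show ?thesis
      by (simp add: insert_action_def lc sum.distrib sum_distrib_left)
  qed
  have B: "insert_action g (wedge \<alpha> \<beta>) \<Omega> xs =
      wedge \<alpha> (interior_product (sharp g \<beta>) \<Omega>) xs - wedge \<beta> (interior_product (sharp g \<alpha>) \<Omega>) xs"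
    if \<alpha>: "\<alpha> \<in> forms 1" and \<beta>: "\<beta> \<in> forms 1" for \<alpha> \<beta> xs
  proof -
    have "sharp g (interior_product x (wedge \<alpha> \<beta>)) = \<alpha> [x] *\<^sub>R sharp g \<beta> + (- \<beta> [x]) *\<^sub>R sharp g \<alpha>" for x
      by (rule sharp_lincomb[OF g d \<beta> \<alpha>])
        (simp add: interior_product_def wedge_one_one[OF \<alpha> \<beta>])
    then show ?thesis
      unfolding wedge_one_interior[OF \<alpha> \<Omega>] wedge_one_interior[OF \<beta> \<Omega>]
      by (simp only: insert_action_def lc sum.distrib) (simp add: sum_negf)
  qed
  show ?thesis
    unfolding is_so_action_def
  proof (intro conjI ballI allI)
    fix \<omega> \<eta> :: "'a form" and a b
    assume \<omega>: "\<omega> \<in> forms 2" and \<eta>: "\<eta> \<in> forms 2"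
    show "insert_action g (\<lambda>xs. a * \<omega> xs + b * \<eta> xs) \<Omega>
        = (\<lambda>xs. a * insert_action g \<omega> \<Omega> xs + b * insert_action g \<eta> \<Omega> xs)"
      by (rule ext, rule A[OF \<omega> \<eta>])
  next
    fix \<alpha> \<beta> :: "'a form"
    assume \<alpha>: "\<alpha> \<in> forms 1" and \<beta>: "\<beta> \<in> forms 1"
    show "insert_action g (wedge \<alpha> \<beta>) \<Omega>
        = (\<lambda>xs. wedge \<alpha> (interior_product (sharp g \<beta>) \<Omega>) xs
              - wedge \<beta> (interior_product (sharp g \<alpha>) \<Omega>) xs)"
      by (rule ext, rule B[OF \<alpha> \<beta>])
  qed
qed

lemma is_so_action_unique:
  fixes g :: "'a::real_vector \<Rightarrow> 'a \<Rightarrow> real"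
  assumes d: "dim (UNIV :: 'a set) > 0" and \<omega>: "\<omega> \<in> forms 2"
    and L: "is_so_action g \<Omega> L" and M: "is_so_action g \<Omega> M"
  shows "L \<omega> = M \<omega>"
proof -
  obtain B :: "'a set" where B: "independent B" "span B = UNIV" "card B = dim (UNIV :: 'a set)"
    by (rule real_vector.basis_exists[of UNIV]) (auto simp: top_unique)
  then have fin: "finite B" using d by (metis card_gt_0_iff)
  define c :: "'a \<Rightarrow> 'a form" where
    "c b = (\<lambda>xs. case xs of [x] \<Rightarrow> representation B x b | _ \<Rightarrow> 0)" for b
  have lin: "L (\<lambda>xs. a * \<mu> xs + b * \<eta> xs) = (\<lambda>xs. a * L \<mu> xs + b * L \<eta> xs)"
    "M (\<lambda>xs. a * \<mu> xs + b * \<eta> xs) = (\<lambda>xs. a * M \<mu> xs + b * M \<eta> xs)"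
    if "\<mu> \<in> forms 2" "\<eta> \<in> forms 2" for a b \<mu> \<eta>
    using L M that unfolding is_so_action_def by blast+
  have c: "c b \<in> forms 1" for b
  proof -
    have "linear (\<lambda>v. c b (as @ v # bs))" for as bs
    proof (cases "as = [] \<and> bs = []")
      case True
      then show ?thesis
        by (intro linearI)
          (simp_all add: c_def real_vector.representation_add[OF B(1)]
            real_vector.representation_scale[OF B(1)] B(2))
    next
      case False
      then have "c b (as @ v # bs) = 0" for v
        by (cases as; cases bs) (auto simp: c_def split: list.splits)
      then show ?thesis by (simp add: linear_zero)
    qed
    moreover have "c b xs = 0" if "length xs \<noteq> 1" for xs
      using that by (auto simp: c_def split: list.splits)
    moreover have "c b xs = 0" if "\<not> distinct xs" for xs
      using that by (auto simp: c_def split: list.splits)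
    ultimately show ?thesis by (auto simp: forms_def)
  qed
  have i: "interior_product b \<omega> \<in> forms 1" for b
    using \<omega> by (auto intro!: interior_product_forms simp: numeral_2_eq_2)
  define S where "S A = (\<lambda>xs. \<Sum>b\<in>A. (1/2) * wedge (c b) (interior_product b \<omega>) xs)" for A
  have S: "S A \<in> forms 2 \<and> L (S A) = M (S A)" if "finite A" for A
    using that
  proof (induction A)
    case empty
    have "(\<lambda>xs. 0 * \<omega> xs + 0 * \<omega> xs) \<in> forms 2" by (rule forms_lincomb[OF \<omega> \<omega>])
    then show ?case using lin[OF \<omega> \<omega>, of 0 0] by (simp add: S_def)
  next
    case (insert b A)
    let ?w = "wedge (c b) (interior_product b \<omega>)"
    have w: "?w \<in> forms 2" by (rule wedge_one_one_forms[OF c i])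
    have "L ?w = M ?w" using L M c i unfolding is_so_action_def by metis
    moreover have "S (insert b A) = (\<lambda>xs. (1/2) * ?w xs + 1 * S A xs)"
      using insert by (simp add: S_def)
    ultimately show ?case
      using lin[OF w, of "S A" "1/2" 1] forms_lincomb[OF w, of "S A" "1/2" 1] insert by simp
  qed
  have "S B xs = \<omega> xs" for xs
  proof (cases "length xs = 2")
    case False
    then show ?thesis
      using formsD_length[OF \<omega>] by (simp add: S_def wedge_one_one_outside[OF c i])
  next
    case True
    then obtain v w where xs: "xs = [v, w]" by (auto simp: numeral_2_eq_2 length_Suc_conv)
    have e: "(\<Sum>b\<in>B. representation B x b * \<omega> [b, y]) = \<omega> [x, y]" for x y
    proof -
      have l: "linear (\<lambda>x. \<omega> [x, y])" using formsD_linear[OF \<omega>, of "[]" "[y]"] by simp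
      have "\<omega> [x, y] = \<omega> [(\<Sum>b\<in>B. representation B x b *\<^sub>R b), y]"
        using real_vector.sum_representation_eq[OF B(1) _ fin subset_refl, of x] B(2) by simp
      also have "\<dots> = (\<Sum>b\<in>B. representation B x b * \<omega> [b, y])"
        by (simp add: linear_sum[OF l] linear_scale[OF l])
      finally show ?thesis by simp
    qed
    have "S B [v, w] = (1/2) * ((\<Sum>b\<in>B. representation B v b * \<omega> [b, w])
        - (\<Sum>b\<in>B. representation B w b * \<omega> [b, v]))"
      unfolding S_def wedge_one_one[OF c i]
      by (simp add: c_def interior_product_def flip: sum_subtractf sum_divide_distrib)
    also have "\<dots> = (1/2) * (\<omega> [v, w] - \<omega> [w, v])"
      by (simp only: e)
    also have "\<dots> = \<omega> [v, w]"
      using forms_swap[OF \<omega>, of "[]" w v "[]"] by simp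
    finally show ?thesis by (simp add: xs)
  qed
  then have "S B = \<omega>" by (rule ext)
  with S[OF fin] show ?thesis by metis
qed

theorem so_action_eq_insert_action:
  fixes g :: "'a::real_vector \<Rightarrow> 'a \<Rightarrow> real"
  assumes "inner_product g" "dim (UNIV :: 'a set) > 0" "\<omega> \<in> forms 2" "\<Omega> \<in> forms p"
  shows "so_action g \<omega> \<Omega> = insert_action g \<omega> \<Omega>"
  unfolding so_action_def
proof (rule the_equality)
  note I = is_so_action_insert_action[OF assms(1,2,4)]
  then show "\<exists>L. is_so_action g \<Omega> L \<and> insert_action g \<omega> \<Omega> = L \<omega>"
    by (intro exI[of _ "\<lambda>\<omega>. insert_action g \<omega> \<Omega>"] conjI refl)
  fix \<Theta> assume "\<exists>L. is_so_action g \<Omega> L \<and> \<Theta> = L \<omega>"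
  then obtain L where L: "is_so_action g \<Omega> L" "\<Theta> = L \<omega>" by blast
  show "\<Theta> = insert_action g \<omega> \<Omega>"
    unfolding L(2) by (rule is_so_action_unique[OF assms(2,3) L(1) I])
qed

theorem is_so_action_so_action:
  fixes g :: "'a::real_vector \<Rightarrow> 'a \<Rightarrow> real"
  assumes "inner_product g" "dim (UNIV :: 'a set) > 0" "\<Omega> \<in> forms p"
  shows "is_so_action g \<Omega> (\<lambda>\<omega>. so_action g \<omega> \<Omega>)"
proof -
  note eq = so_action_eq_insert_action[OF assms(1,2) _ assms(3)]
  note I = is_so_action_insert_action[OF assms, unfolded is_so_action_def]
  show ?thesis
    unfolding is_so_action_def
  proof (intro conjI ballI allI)
    fix \<omega> \<eta> :: "'a form" and a b
    assume \<omega>: "\<omega> \<in> forms 2" and \<eta>: "\<eta> \<in> forms 2"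
    show "so_action g (\<lambda>xs. a * \<omega> xs + b * \<eta> xs) \<Omega>
        = (\<lambda>xs. a * so_action g \<omega> \<Omega> xs + b * so_action g \<eta> \<Omega> xs)"
      unfolding eq[OF \<omega>] eq[OF \<eta>] eq[OF forms_lincomb[OF \<omega> \<eta>]]
      by (rule I[THEN conjunct1, rule_format, OF \<omega> \<eta>])
  next
    fix \<alpha> \<beta> :: "'a form"
    assume \<alpha>: "\<alpha> \<in> forms 1" and \<beta>: "\<beta> \<in> forms 1"
    show "so_action g (wedge \<alpha> \<beta>) \<Omega>
        = (\<lambda>xs. wedge \<alpha> (interior_product (sharp g \<beta>) \<Omega>) xs
              - wedge \<beta> (interior_product (sharp g \<alpha>) \<Omega>) xs)"
      unfolding eq[OF wedge_one_one_forms[OF \<alpha> \<beta>]]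
      by (rule I[THEN conjunct2, rule_format, OF \<alpha> \<beta>])
  qed
qed

end

theory Submission
  imports Defs
begin

text \<open>
  Let \<open>[x, y]\<close> be the vector with \<open>\<langle>[x, y], w\<rangle> = F(x, y, w)\<close>. The condition says that every
  \<open>[X, -]\<close> annihilates \<open>F\<close>, which is the Jacobi identity for this bracket. For
  \<open>F = \<alpha> \<and> \<beta> \<and> \<gamma>\<close> it is a polynomial identity in the values and the inner products of
  \<open>\<alpha>, \<beta>, \<gamma>\<close>.

  Conversely, let \<open>F(a, b, c) = 1\<close> and let \<open>W\<close> be the common kernel of \<open>F(-, b, c)\<close>,
  \<open>F(a, -, c)\<close>, \<open>F(a, b, -)\<close>, a complement of the span of \<open>a, b, c\<close> and so of dimension at most 2.
  Then \<open>F\<close> is the product of these three one-forms unless \<open>F(x, p, q) \<noteq> 0\<close> for some \<open>p, q\<close> in \<open>W\<close>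
  and \<open>x\<close> among \<open>a, b, c\<close>. In that case \<open>F\<close> looks like \<open>a\<^sup>* \<and> (b\<^sup>* \<and> c\<^sup>* + p\<^sup>* \<and> q\<^sup>*)\<close> after
  a change of basis. Since \<open>[b, p] = [b, q] = [c, p] = [c, q] = 0\<close>, and \<open>[b, c]\<close> and \<open>[p, q]\<close>
  are proportional, the Jacobi identity puts \<open>[b, c]\<close> into the radical of \<open>F\<close>, which is zero,
  whereas \<open>\<langle>[b, c], a\<rangle> = F(a, b, c) \<noteq> 0\<close>.
\<close>

section \<open>Independence and dimension\<close>

lemma independent_card_le_dim_UNIV:
  fixes S :: "'a::real_vector set"
  assumes "dim (UNIV :: 'a set) > 0" "independent S"
  shows "card S \<le> dim (UNIV :: 'a set)"
proof -
  obtain B :: "'a set" where B: "independent B" "span B = UNIV" "card B = dim (UNIV :: 'a set)"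
    by (rule real_vector.basis_exists[of UNIV]) (auto simp: top_unique)
  \<comment> \<open>An infinite basis would have \<open>card\<close> equal to 0, so positive
    dimension forces finiteness.\<close>
  then have "finite B" using assms(1) by (metis card_gt_0_iff)
  from real_vector.independent_span_bound[OF this assms(2)] B show ?thesis by auto
qed

lemma notin_span_functional:
  fixes \<phi> :: "'a::real_vector \<Rightarrow> real"
  assumes "linear \<phi>" "\<And>s. s \<in> S \<Longrightarrow> \<phi> s = 0" "\<phi> x \<noteq> 0"
  shows "x \<notin> span S"
  using linear_eq_0_on_span[OF assms(1), of S x] assms(2,3) by blast

text \<open>A functional vanishing on \<open>S\<close> but not at \<open>x\<close> separates
  \<open>x\<close> from the span of \<open>S\<close>. The conclusion repeats the shape of the first
  premise, so that the rule can be chained, one vector at a time.\<close>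

lemma independent_insert_functional:
  fixes \<phi> :: "'a::real_vector \<Rightarrow> real"
  assumes "independent S \<and> finite S \<and> card S = n"
    and "linear \<phi>" "\<And>s. s \<in> S \<Longrightarrow> \<phi> s = 0" "\<phi> x \<noteq> 0"
  shows "independent (insert x S) \<and> finite (insert x S) \<and> card (insert x S) = Suc n"
proof -
  have x: "x \<notin> span S" by (rule notin_span_functional[OF assms(2-4)])
  then have "x \<notin> S" using real_vector.span_base by blast
  with real_vector.independent_insertI[OF x] assms(1) show ?thesis by auto
qed

section \<open>Alternating trilinear forms and determinants\<close>

locale alternating_trilinear =
  fixes f :: "'a::real_vector \<Rightarrow> 'a \<Rightarrow> 'a \<Rightarrow> real"
  assumes linear1: "linear (\<lambda>x. f x y z)"
    and swap12: "f y x z = - f x y z"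
    and swap23: "f x z y = - f x y z"
begin

lemma cyclic: "f y z x = f x y z"
  by (metis swap12 swap23)

lemma linear2: "linear (\<lambda>y. f x y z)"
  using linear1[of z x] by (subst (asm) cyclic)

lemma linear3: "linear (\<lambda>z. f x y z)"
proof -
  have "(\<lambda>z. f x y z) = (\<lambda>z. f z x y)" by (rule ext) (rule cyclic)
  then show ?thesis using linear1[of x y] by simp
qed

lemma zero_perms:
  "f x y z = 0 \<Longrightarrow> f x z y = 0 \<and> f y x z = 0 \<and> f y z x = 0 \<and> f z x y = 0 \<and> f z y x = 0"
  by (metis cyclic swap12 neg_equal_0_iff_equal)

lemmas linear_simps =
  linear_add[OF linear1] linear_add[OF linear2] linear_add[OF linear3]
  linear_diff[OF linear1] linear_diff[OF linear2] linear_diff[OF linear3]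
  linear_scale[OF linear1] linear_scale[OF linear2] linear_scale[OF linear3]

lemma repeated [simp]: "f x x y = 0" "f y x x = 0" "f x y x = 0"
  using swap12[of x x y] swap23[of y x x] cyclic[of x y x] by auto

text \<open>Vectors split into a part in the span of \<open>a\<close>, \<open>b\<close>,
  \<open>c\<close> and a part in \<open>W\<close>. By the definition of \<open>W\<close> and the two
  vanishing hypotheses, \<open>f\<close> is zero as soon as one argument lies in \<open>W\<close>.
  What remains is the 3 by 3 determinant of the coordinates.\<close>

lemma eq_det:
  assumes abc: "f a b c = 1"
    and W: "W = {w. f w b c = 0 \<and> f a w c = 0 \<and> f a b w = 0}"
    and 1: "\<And>x w w'. x \<in> {a, b, c} \<Longrightarrow> w \<in> W \<Longrightarrow> w' \<in> W \<Longrightarrow> f x w w' = 0"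
    and 0: "\<And>w w' w''. w \<in> W \<Longrightarrow> w' \<in> W \<Longrightarrow> w'' \<in> W \<Longrightarrow> f w w' w'' = 0"
  shows "f x y z =
    f x b c * (f a y c * f a b z - f a z c * f a b y)
    - f y b c * (f a x c * f a b z - f a z c * f a b x)
    + f z b c * (f a x c * f a b y - f a y c * f a b x)"
proof -
  have zero: "f b a w = 0" "f a c w = 0" "f c a w = 0" "f b c w = 0" "f c b w = 0" "f a b w = 0"
    if "w \<in> W" for w
    using that zero_perms[of a b w] zero_perms[of a w c] zero_perms[of w b c] unfolding W by auto
  \<comment> \<open>Since \<open>f a b c = 1\<close>, the three coefficients are the coordinates
    along \<open>a\<close>, \<open>b\<close>, \<open>c\<close>, and \<open>w\<close> is the
    projection onto \<open>W\<close>.\<close>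
  define w where "w x = x - (f x b c *\<^sub>R a + f a x c *\<^sub>R b + f a b x *\<^sub>R c)" for x
  have w: "w x \<in> W" for x
    unfolding W w_def by (simp add: linear_simps abc)
  have split: "x = f x b c *\<^sub>R a + f a x c *\<^sub>R b + f a b x *\<^sub>R c + w x" for x
    by (simp add: w_def)
  have span: "x \<in> span ({a, b, c} \<union> W)" for x
    by (subst split) (intro span_add span_scale span_base; use w in auto)
  \<comment> \<open>With the last slot in \<open>W\<close>, vanishing extends from the spanning set
    to all vectors in the second slot here, and in the first slot in \<open>B\<close>.\<close>
  have A: "f x y v = 0" if v: "v \<in> W" and x: "x \<in> {a, b, c} \<union> W" for x y v
  proof (rule linear_eq_0_on_span[OF linear2 _ span])
    fix y assume y: "y \<in> {a, b, c} \<union> W"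
    show "f x y v = 0"
      using x y zero[OF v] 1[of _ _ v] 0[of x y v] v 1[of y x v] swap12[of x y v]
      by auto
  qed
  have B: "f x y v = 0" if v: "v \<in> W" for x y v
    by (rule linear_eq_0_on_span[OF linear1 A[OF v] span])
  have C: "f v x y = 0" "f x v y = 0" if "v \<in> W" for x y v
    using B[OF that] by (metis cyclic)+
  have perm: "f a c b = -1" "f b a c = -1" "f b c a = 1" "f c a b = 1" "f c b a = -1"
    using abc by (metis cyclic swap12)+
  have "f x y z = f (f x b c *\<^sub>R a + f a x c *\<^sub>R b + f a b x *\<^sub>R c + w x)
     (f y b c *\<^sub>R a + f a y c *\<^sub>R b + f a b y *\<^sub>R c + w y)
     (f z b c *\<^sub>R a + f a z c *\<^sub>R b + f a b z *\<^sub>R c + w z)"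
    using split by metis
  also have "\<dots> = f x b c * (f a y c * f a b z - f a z c * f a b y)
    - f y b c * (f a x c * f a b z - f a z c * f a b x)
    + f z b c * (f a x c * f a b y - f a y c * f a b x)"
    unfolding linear_add[OF linear1] linear_add[OF linear2] linear_add[OF linear3]
    unfolding linear_scale[OF linear1] linear_scale[OF linear2] linear_scale[OF linear3]
    by (simp add: B[OF w] C[OF w] perm abc) (simp add: algebra_simps)
  finally show ?thesis .
qed

end

section \<open>The Jacobi identity and the exclusion of rank five\<close>

text \<open>The assumption \<open>jacobi\<close> says that \<open>br x\<close>, acting as a
  derivation, annihilates \<open>f\<close>. Moving \<open>br x w\<close> across \<open>g\<close>
  turns it into the Jacobi identity for \<open>br\<close>.\<close>

locale invariant_bracket = alternating_trilinear f
  for f :: "'a::real_vector \<Rightarrow> 'a \<Rightarrow> 'a \<Rightarrow> real" +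
  fixes g :: "'a \<Rightarrow> 'a \<Rightarrow> real" and br :: "'a \<Rightarrow> 'a \<Rightarrow> 'a"
  assumes g: "inner_product g"
    and br: "g (br x y) w = f x y w"
    and jacobi: "f (br x u) v w + f u (br x v) w + f u v (br x w) = 0"
begin

lemma linear_g1: "linear (\<lambda>x. g x y)"
  using g by (auto simp: inner_product_def bilinear_def)

lemma g_eqI: "(\<And>w. g u w = g v w) \<Longrightarrow> u = v"
proof -
  assume "\<And>w. g u w = g v w"
  then have "g (u - v) w = 0" for w by (simp add: linear_diff[OF linear_g1])
  then have "u - v = 0" using g unfolding inner_product_def by blast
  then show ?thesis by simp
qed

lemma br_eq_0: "(\<And>w. f x y w = 0) \<Longrightarrow> br x y = 0"
  by (rule g_eqI) (simp add: br linear_0[OF linear_g1])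

text \<open>Of the ten triples among the five vectors, only \<open>a, b, c\<close> and
  \<open>a, p, q\<close> have nonzero value. The dimension bound makes the vectors a basis, so
  \<open>f\<close> has zero radical, yet \<open>br b c\<close> is shown to lie in it.\<close>

lemma not_rank_five_normalised:
  assumes d: "dim (UNIV :: 'a set) > 0" "dim (UNIV :: 'a set) \<le> 5"
    and nz: "f a b c \<noteq> 0" "f a p q \<noteq> 0"
    and zp: "f a b p = 0" "f a c p = 0" "f b c p = 0"
    and zq: "f a b q = 0" "f a c q = 0" "f b c q = 0"
    and zpq: "f b p q = 0" "f c p q = 0"
  shows False
proof -
  let ?S = "{a, b, c, p, q}"
  note z = zp zq zpq
  note zs = z z[THEN zero_perms]
  \<comment> \<open>Each vector is separated from the later ones by \<open>f\<close> with two slots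
    filled by its partners.\<close>
  have "independent ?S \<and> finite ?S \<and> card ?S = Suc (Suc (Suc (Suc (Suc 0))))"
    by (rule independent_insert_functional[OF _ linear1[of b c]],
        rule independent_insert_functional[OF _ linear2[of a c]],
        rule independent_insert_functional[OF _ linear3[of a b]],
        rule independent_insert_functional[OF _ linear2[of a q]],
        rule independent_insert_functional[OF _ linear3[of a p]])
      (use nz zs in \<open>auto simp: real_vector.independent_empty\<close>)
  then have S: "independent ?S" "finite ?S" "card ?S = 5" by auto
  have span: "x \<in> span ?S" for x
  proof (rule ccontr)
    assume x: "x \<notin> span ?S"
    then have "independent (insert x ?S)" using S(1) by (rule real_vector.independent_insertI)
    then have "card (insert x ?S) \<le> 5"
      using independent_card_le_dim_UNIV[OF d(1)] d(2) le_trans by blast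
    moreover have "x \<notin> ?S" using x real_vector.span_base[of x ?S] by blast
    ultimately show False using S by (simp add: card_insert_disjoint)
  qed
  have "f b p x = 0" "f b q x = 0" "f c p x = 0" "f c q x = 0" for x
    by (rule linear_eq_0_on_span[OF linear3 _ span[of x]], auto simp: zs)+
  then have cross: "f u w x = 0" if "u \<in> {b, c} \<and> w \<in> {p, q} \<or> u \<in> {p, q} \<and> w \<in> {b, c}" for u w x
    using that by (auto simp: swap12[of p] swap12[of q])
  then have brcross: "br u w = 0"
    if "u \<in> {b, c} \<and> w \<in> {p, q} \<or> u \<in> {p, q} \<and> w \<in> {b, c}" for u w
    using that by (intro br_eq_0) blast
  define n where "n = br b c"
  \<comment> \<open>In the Jacobi identity for \<open>br b\<close> at \<open>c\<close>,
    \<open>w\<close>, \<open>x\<close>, the second term dies because \<open>br b w = 0\<close>, the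
    third because \<open>f c w\<close> vanishes identically.\<close>
  have n1: "f n w x = 0" if "w \<in> {p, q}" for w x
    using jacobi[of b c w x] cross[of c w "br b x"] brcross[of b w] that
    unfolding n_def by (auto simp: linear_0[OF linear2])
  have m1: "f (br p q) w x = 0" if "w \<in> {b, c}" for w x
    using jacobi[of p q w x] cross[of q w "br p x"] brcross[of p w] that
    by (auto simp: linear_0[OF linear2])
  \<comment> \<open>Both \<open>f p q\<close> and \<open>f b c\<close> vanish at \<open>b\<close>,
    \<open>c\<close>, \<open>p\<close>, \<open>q\<close>, hence are proportional; the ratio is read
    off at \<open>a\<close>.\<close>
  have "f a b c * f p q x - f a p q * f b c x = 0" for x
  proof (rule linear_eq_0_on_span[OF _ _ span[of x]])
    show "linear (\<lambda>x. f a b c * f p q x - f a p q * f b c x)"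
      by (rule linearI) (simp_all add: linear_simps algebra_simps)
  qed (use zs in \<open>auto simp: cyclic[of _ _ a]\<close>)
  then have mn: "f a b c *\<^sub>R br p q = f a p q *\<^sub>R n"
    by (intro g_eqI) (simp add: n_def linear_scale[OF linear_g1] br)
  have n2: "f n w x = 0" if "w \<in> {b, c}" for w x
  proof -
    have "f a p q * f n w x = f (f a b c *\<^sub>R br p q) w x" by (simp add: linear_simps mn)
    also have "\<dots> = 0" using m1[OF that] by (simp add: linear_simps)
    finally show ?thesis using nz by simp
  qed
  obtain k1 k2 k3 k4 k5 where "n - k1 *\<^sub>R a - k2 *\<^sub>R b - k3 *\<^sub>R c - k4 *\<^sub>R p - k5 *\<^sub>R q = 0"
    using span[of n] by (auto simp: real_vector.span_breakdown_eq)
  then have n: "n = k1 *\<^sub>R a + k2 *\<^sub>R b + k3 *\<^sub>R c + k4 *\<^sub>R p + k5 *\<^sub>R q"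
    by (simp add: algebra_simps)
  have perm: "f b c a = f a b c" "f c b a = - f a b c" "f p q a = f a p q" "f q p a = - f a p q"
    by (metis cyclic swap12)+
  \<comment> \<open>Each listed pairing of \<open>n\<close> with two basis vectors isolates one
    coefficient.\<close>
  have "k1 = 0" "k2 = 0" "k3 = 0" "k4 = 0" "k5 = 0"
    using n2[of b c] n2[of c a] n2[of b a] n1[of p a] n1[of q a] nz
    by (simp_all add: n linear_simps zs perm)
  then have "n = 0" by (simp add: n)
  then have "f b c a = 0" using br[of b c a] by (simp add: n_def linear_0[OF linear_g1])
  then show False using nz cyclic[of b c a] by simp
qed

lemma not_rank_five:
  assumes d: "dim (UNIV :: 'a set) > 0" "dim (UNIV :: 'a set) \<le> 5"
    and nz: "f a b c \<noteq> 0"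
    and zp: "f a b p = 0" "f a c p = 0" "f b c p = 0"
    and zq: "f a b q = 0" "f a c q = 0" "f b c q = 0"
  shows "f a p q = 0"
proof (rule ccontr)
  assume nz': "f a p q \<noteq> 0"
  \<comment> \<open>Subtracting these multiples of \<open>a\<close> makes \<open>f b' p q\<close>
    and \<open>f c' p q\<close> vanish without changing \<open>f a b' c'\<close>, which reduces to
    the normalised case.\<close>
  define b' c' where "b' = b - (f b p q / f a p q) *\<^sub>R a" and "c' = c - (f c p q / f a p q) *\<^sub>R a"
  have "f b a p = 0" "f b a q = 0" using zp zq swap12[of b a] by auto
  then show False
    using nz nz' zp zq
    by (intro not_rank_five_normalised[OF d, of a b' c' p q]) (simp_all add: b'_def c'_def linear_simps)
qed

text \<open>The hypotheses of \<open>eq_det\<close> hold: terms with two arguments in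
  \<open>W\<close> vanish by \<open>not_rank_five\<close> applied to the cyclic permutations of
  \<open>a\<close>, \<open>b\<close>, \<open>c\<close>, and a nonzero value on \<open>W\<close>
  would produce six independent vectors.\<close>

lemma decomposable:
  assumes d: "dim (UNIV :: 'a set) > 0" "dim (UNIV :: 'a set) \<le> 5"
    and nz: "f a b c = 1"
  shows "f x y z =
    f x b c * (f a y c * f a b z - f a z c * f a b y)
    - f y b c * (f a x c * f a b z - f a z c * f a b x)
    + f z b c * (f a x c * f a b y - f a y c * f a b x)"
proof -
  define W where "W = {w. f w b c = 0 \<and> f a w c = 0 \<and> f a b w = 0}"
  have W: "f a b w = 0" "f a c w = 0" "f b c w = 0" "f b a w = 0" "f c a w = 0" "f c b w = 0"
    if "w \<in> W" for w
    using that zero_perms[of a b w] zero_perms[of a w c] zero_perms[of w b c] unfolding W_def by auto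
  have nz': "f b c a \<noteq> 0" "f c a b \<noteq> 0" using nz cyclic[of b c a] cyclic[of c a b] by simp_all
  have 1: "f x w w' = 0" if "x \<in> {a, b, c}" "w \<in> W" "w' \<in> W" for x w w'
    using that nz nz' W[of w] W[of w'] not_rank_five[OF d, of a b c w w']
      not_rank_five[OF d, of b c a w w'] not_rank_five[OF d, of c a b w w'] by auto
  have "f w w' w'' = 0" if w: "w \<in> W" "w' \<in> W" "w'' \<in> W" for w w' w''
  proof (rule ccontr)
    assume nzw: "f w w' w'' \<noteq> 0"
    let ?S = "{a, b, c, w, w', w''}"
    have "independent ?S \<and> finite ?S \<and> card ?S = Suc (Suc (Suc (Suc (Suc (Suc 0)))))"
      by (rule independent_insert_functional[OF _ linear1[of b c]],
          rule independent_insert_functional[OF _ linear2[of a c]],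
          rule independent_insert_functional[OF _ linear3[of a b]],
          rule independent_insert_functional[OF _ linear1[of w' w'']],
          rule independent_insert_functional[OF _ linear2[of w w'']],
          rule independent_insert_functional[OF _ linear3[of w w']])
        (use nz nzw w in \<open>auto simp: W_def real_vector.independent_empty\<close>)
    then have "independent ?S" "card ?S = 6" by auto
    then show False using independent_card_le_dim_UNIV[OF d(1), of ?S] d(2) by linarith
  qed
  from eq_det[OF nz W_def 1 this] show ?thesis .
qed

end

section \<open>Wedge products of one-forms and the action on three-forms\<close>

lemma wedge_three:
  assumes "\<alpha> \<in> forms 1" "\<beta> \<in> forms 1" "\<gamma> \<in> forms 1"
  shows "foldr wedge [\<alpha>, \<beta>, \<gamma>] unit_form [x, y, z] =
    \<alpha> [x] * (\<beta> [y] * \<gamma> [z] - \<beta> [z] * \<gamma> [y])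
    - \<alpha> [y] * (\<beta> [x] * \<gamma> [z] - \<beta> [z] * \<gamma> [x])
    + \<alpha> [z] * (\<beta> [x] * \<gamma> [y] - \<beta> [y] * \<gamma> [x])"
proof -
  have "wedge \<gamma> unit_form [v] = \<gamma> [v]" for v
    by (simp add: wedge_one_form[OF assms(3)] unit_form_def)
  then have "wedge \<beta> (wedge \<gamma> unit_form) [v, w] = \<beta> [v] * \<gamma> [w] - \<beta> [w] * \<gamma> [v]" for v w
    by (simp add: wedge_one_form[OF assms(2)])
  then show ?thesis
    by (simp add: wedge_one_form[OF assms(1)])
qed

lemma wedge_foldr_outside:
  assumes "set \<alpha>s \<subseteq> forms 1" "length xs \<noteq> length \<alpha>s"
  shows "foldr wedge \<alpha>s unit_form xs = 0"
  using assms
proof (induction \<alpha>s arbitrary: xs)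
  case Nil
  then show ?case by (simp add: unit_form_def)
next
  case (Cons \<alpha> \<alpha>s)
  then have "\<alpha> \<in> forms 1" by simp
  then show ?case
    unfolding foldr.simps comp_def
    by (subst wedge_one_form) (use Cons in \<open>auto intro!: sum.neutral\<close>)
qed

lemma alternating_trilinear_forms:
  assumes "F \<in> forms 3"
  shows "alternating_trilinear (\<lambda>x y z. F [x, y, z])"
proof (rule alternating_trilinear.intro)
  show "linear (\<lambda>x. F [x, y, z])" for y z
    using formsD_linear[OF assms, of "[]" "[y, z]"] by simp
  show "F [y, x, z] = - F [x, y, z]" for x y z
    using forms_swap[OF assms, of "[]" y x "[z]"] by simp
  show "F [x, z, y] = - F [x, y, z]" for x y z
    using forms_swap[OF assms, of "[x]" z y "[]"] by simp
qed

lemma one_formI: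
  assumes "linear \<phi>"
  shows "(\<lambda>xs. case xs of [x] \<Rightarrow> \<phi> x | _ \<Rightarrow> 0) \<in> forms 1" (is "?\<alpha> \<in> _")
proof -
  have "linear (\<lambda>v. ?\<alpha> (as @ v # bs))" for as bs
  proof (cases "as = [] \<and> bs = []")
    case True
    then show ?thesis using assms by simp
  next
    case False
    then have "?\<alpha> (as @ v # bs) = 0" for v
      by (cases as; cases bs) (auto split: list.splits)
    then show ?thesis by (simp add: linear_zero)
  qed
  then show ?thesis by (auto simp: forms_def split: list.splits)
qed

text \<open>Under the two-form \<open>interior_product X F\<close>, the endomorphism inserted by
  \<open>insert_action\<close> is \<open>br X\<close>. Only lists of length 3 matter, as
  \<open>F\<close> is zero on all others.\<close>

lemma so_action_eq_0_iff:
  fixes g :: "'a::real_vector \<Rightarrow> 'a \<Rightarrow> real"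
  assumes g: "inner_product g" and d: "dim (UNIV :: 'a set) > 0" and F: "F \<in> forms 3"
    and br: "\<And>x y. br x y = sharp g (interior_product y (interior_product x F))"
  shows "so_action g (interior_product X F) F = (\<lambda>_. 0) \<longleftrightarrow>
    (\<forall>u v w. F [br X u, v, w] + F [u, br X v, w] + F [u, v, br X w] = 0)"
proof -
  have "interior_product X F \<in> forms 2"
    using F by (auto intro!: interior_product_forms simp: eval_nat_numeral)
  then have eq: "so_action g (interior_product X F) F = insert_action g (interior_product X F) F"
    by (rule so_action_eq_insert_action[OF g d _ F])
  have 3: "insert_action g (interior_product X F) F [u, v, w] =
      F [br X u, v, w] + F [u, br X v, w] + F [u, v, br X w]" for u v w
    by (simp add: insert_action_def br numeral_3_eq_3 lessThan_Suc)
  have other: "insert_action g (interior_product X F) F xs = 0" if "length xs \<noteq> 3" for xs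
    unfolding insert_action_def
    by (rule sum.neutral) (use that in \<open>auto intro!: formsD_length[OF F]\<close>)
  have "insert_action g (interior_product X F) F = (\<lambda>_. 0) \<longleftrightarrow>
      (\<forall>u v w. insert_action g (interior_product X F) F [u, v, w] = 0)"
  proof
    assume R: "\<forall>u v w. insert_action g (interior_product X F) F [u, v, w] = 0"
    show "insert_action g (interior_product X F) F = (\<lambda>_. 0)"
    proof
      fix xs
      show "insert_action g (interior_product X F) F xs = 0"
        using R other[of xs] by (cases "length xs = 3") (auto simp: numeral_3_eq_3 length_Suc_conv)
    qed
  qed simp
  then show ?thesis by (simp only: eq 3)
qed

section \<open>The equivalence\<close>

theorem mainTheorem6:
  fixes g :: "'a::real_vector \<Rightarrow> 'a \<Rightarrow> real" and F :: "'a form" and d :: nat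
  assumes "dim (UNIV :: 'a set) = d" and "3 \<le> d" and "d < 6"
    and "euclidean_product g \<or> lorentzian_product g"
    and "F \<in> forms 3"
  shows "(\<forall>X. so_action g (interior_product X F) F = (\<lambda>_. 0)) \<longleftrightarrow> simple_form 3 F"
proof -
  have d: "dim (UNIV :: 'a set) > 0" "dim (UNIV :: 'a set) \<le> 5" using assms(1-3) by auto
  have g: "inner_product g"
    using assms(4) by (auto simp: euclidean_product_def lorentzian_product_def)
  note F = assms(5)
  define br where "br x y = sharp g (interior_product y (interior_product x F))" for x y
  have ip: "interior_product y (interior_product x F) \<in> forms 1" for x y
    using F by (auto intro!: interior_product_forms simp: eval_nat_numeral)
  have br: "g (br x y) w = F [x, y, w]" for x y w
    unfolding br_def sharp_works[OF g d(1) ip] by (simp add: interior_product_def)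
  interpret alternating_trilinear "\<lambda>x y z. F [x, y, z]"
    by (rule alternating_trilinear_forms[OF F])
  have iff: "(\<forall>X. so_action g (interior_product X F) F = (\<lambda>_. 0)) \<longleftrightarrow>
    (\<forall>X u v w. F [br X u, v, w] + F [u, br X v, w] + F [u, v, br X w] = 0)"
    using so_action_eq_0_iff[OF g d(1) F br_def] by simp
  show ?thesis
    unfolding iff
  proof
    assume J: "\<forall>X u v w. F [br X u, v, w] + F [u, br X v, w] + F [u, v, br X w] = 0"
    then interpret invariant_bracket "\<lambda>x y z. F [x, y, z]" g br
      by unfold_locales (auto simp: g br)
    have "\<exists>\<alpha>\<in>forms 1. \<exists>\<beta>\<in>forms 1. \<exists>\<gamma>\<in>forms 1. \<forall>x y z. F [x, y, z] =
        foldr wedge [\<alpha>, \<beta>, \<gamma>] unit_form [x, y, z]"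
    proof (cases "\<forall>x y z. F [x, y, z] = 0")
      case True
      have zero: "(\<lambda>_. 0) \<in> (forms 1 :: 'a form set)"
        by (simp add: forms_def linear_zero)
      then have "F [x, y, z] = foldr wedge [\<lambda>_. 0, \<lambda>_. 0, \<lambda>_. 0] unit_form [x, y, z]" for x y z
        by (subst wedge_three) (use True in simp_all)
      with zero show ?thesis by blast
    next
      case False
      then obtain a0 b c where nz: "F [a0, b, c] \<noteq> 0" by blast
      define a where "a = (1 / F [a0, b, c]) *\<^sub>R a0"
      have abc: "F [a, b, c] = 1" using nz by (simp add: a_def linear_simps)
      \<comment> \<open>Turns a functional into a one-form on lists; the three factors are
        \<open>F\<close> with two of \<open>a\<close>, \<open>b\<close>, \<open>c\<close> filled
        in.\<close>
      let ?\<phi> = "\<lambda>\<phi> xs. case xs of [x] \<Rightarrow> \<phi> x | _ \<Rightarrow> 0"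
      have "?\<phi> (\<lambda>x. F [x, b, c]) \<in> forms 1" "?\<phi> (\<lambda>x. F [a, x, c]) \<in> forms 1"
        "?\<phi> (\<lambda>x. F [a, b, x]) \<in> forms 1"
        by (intro one_formI linear1 linear2 linear3)+
      moreover from this have "F [x, y, z] = foldr wedge
          [?\<phi> (\<lambda>x. F [x, b, c]), ?\<phi> (\<lambda>x. F [a, x, c]), ?\<phi> (\<lambda>x. F [a, b, x])] unit_form [x, y, z]"
        for x y z
        by (subst wedge_three) (use decomposable[OF d abc, of x y z] in simp_all)
      ultimately show ?thesis by blast
    qed
    then obtain \<alpha> \<beta> \<gamma> where abg: "\<alpha> \<in> forms 1" "\<beta> \<in> forms 1" "\<gamma> \<in> forms 1"
      and eq: "\<And>x y z. F [x, y, z] = foldr wedge [\<alpha>, \<beta>, \<gamma>] unit_form [x, y, z]" by blast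
    have "F xs = foldr wedge [\<alpha>, \<beta>, \<gamma>] unit_form xs" for xs
    proof (cases "length xs = 3")
      case True
      then obtain x y z where "xs = [x, y, z]" by (auto simp: numeral_3_eq_3 length_Suc_conv)
      then show ?thesis using eq by simp
    next
      case False
      then show ?thesis
        using formsD_length[OF F False] wedge_foldr_outside[of "[\<alpha>, \<beta>, \<gamma>]" xs] abg by simp
    qed
    then have "F = foldr wedge [\<alpha>, \<beta>, \<gamma>] unit_form" by (rule ext)
    then show "simple_form 3 F"
      unfolding simple_form_def by (intro exI[of _ "[\<alpha>, \<beta>, \<gamma>]"]) (use abg in simp)
  next
    assume "simple_form 3 F"
    then obtain \<alpha> \<beta> \<gamma> where abg: "\<alpha> \<in> forms 1" "\<beta> \<in> forms 1" "\<gamma> \<in> forms 1"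
      and Feq: "F = foldr wedge [\<alpha>, \<beta>, \<gamma>] unit_form"
      unfolding simple_form_def by (auto simp: numeral_3_eq_3 length_Suc_conv)
    note F3 = wedge_three[OF abg, folded Feq]
    have sym: "g x y = g y x" for x y using g by (simp add: inner_product_def)
    \<comment> \<open>This eliminates \<open>br\<close>: a one-form evaluated on a bracket becomes a
      value of \<open>F\<close> on a \<open>sharp\<close>.\<close>
    have val: "\<delta> [br x y] = F [x, y, sharp g \<delta>]" if "\<delta> \<in> forms 1" for \<delta> x y
      using sharp_works[OF g d(1) that, of "br x y"] br[of x y "sharp g \<delta>"] sym by simp
    \<comment> \<open>The induced product on one-forms is symmetric; orienting mixed products one
      way lets equal terms cancel below.\<close>
    have gsym: "\<delta> [sharp g \<epsilon>] = \<epsilon> [sharp g \<delta>]" if "\<delta> \<in> forms 1" "\<epsilon> \<in> forms 1" for \<delta> \<epsilon>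
      using sharp_works[OF g d(1) that(1)] sharp_works[OF g d(1) that(2)] sym by metis
    show "\<forall>X u v w. F [br X u, v, w] + F [u, br X v, w] + F [u, v, br X w] = 0"
    proof (intro allI)
      fix X u v w
      show "F [br X u, v, w] + F [u, br X v, w] + F [u, v, br X w] = 0"
        \<comment> \<open>The second use of \<open>F3\<close> expands the values of \<open>F\<close>
          that \<open>val\<close> has introduced.\<close>
        unfolding F3 val[OF abg(1)] val[OF abg(2)] val[OF abg(3)]
        unfolding F3 gsym[OF abg(2,1)] gsym[OF abg(3,1)] gsym[OF abg(3,2)]
        by (simp add: algebra_simps)
    qed
  qed
qed

end
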